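(* Let $b$ be a prime, $m\in\mathbb{N}$, $N=b^m$, $s\in\mathbb{N}$, $\alpha>1$, let $(\gamma_{\mathfrak{u}})_{\mathfrak{u}\subseteq[s]}$ be positive weights with $\gamma_\emptyset=1$, let $0\le w_1\le\cdots\le w_s$ be integers and $Y_j=b^{w_j}$. Let the initial vector $\boldsymbol{z}^0\in\{0,1,\ldots,N-1\}^s$ be of the form $\boldsymbol{z}^0\equiv(Y_1\bar z_1,\ldots,Y_s\bar z_s)\pmod N$ with $\bar z_j\in\mathcal{Z}_{N,w_j}$ for all $j\in[s]$, and let $\boldsymbol{z}$ be the result of the reduced successive coordinate search (SCS) algorithm (defined in the context) with initial vector $\boldsymbol{z}^0$. Then $$e_{N,s}(\boldsymbol{z})\le e_{N,s}(\boldsymbol{z}^0),$$ i.e., the constructed vector $\boldsymbol{z}$ is always at least as good as the initial vector $\boldsymbol{z}^0$ with respect to the associated worst-case error.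
   Context: Notation: $[s]=\{1,\ldots,s\}$, $\mathbb{Z}_*=\mathbb{Z}\setminus\{0\}$; for a vector $\boldsymbol{x}$ and $\mathfrak{u}\subseteq[s]$, $\boldsymbol{x}_{\mathfrak{u}}=(x_j)_{j\in\mathfrak{u}}$; $\{\cdot\}$ is the fractional part, applied componentwise. Weighted Korobov space: $\mathcal{H}(K_{s,\alpha,\boldsymbol{\gamma}})$ is the reproducing kernel Hilbert space of functions on $[0,1]^s$ with kernel $$K_{s,\alpha,\boldsymbol{\gamma}}(\boldsymbol{x},\boldsymbol{y})=1+\sum_{\emptyset\ne\mathfrak{u}\subseteq[s]}\gamma_{\mathfrak{u}}\sum_{\boldsymbol{h}_{\mathfrak{u}}\in\mathbb{Z}_*^{|\mathfrak{u}|}}\frac{\exp(2\pi \mathrm{i}\,\boldsymbol{h}_{\mathfrak{u}}\cdot(\boldsymbol{x}_{\mathfrak{u}}-\boldsymbol{y}_{\mathfrak{u}}))}{\prod_{j\in\mathfrak{u}}|h_j|^\alpha}.$$ Worst-case error: for $\boldsymbol{\xi}\in\mathbb{Z}^s$, $e_{N,s}(\boldsymbol{\xi})$ is the supremum of $\left|\int_{[0,1]^s}f(\boldsymbol{x})\,\mathrm{d}\boldsymbol{x}-\frac1N\sum_{n=0}^{N-1}f(\{n\boldsymbol{\xi}/N\})\right|$ over all $f$ in the unit ball of $\mathcal{H}(K_{s,\alpha,\boldsymbol{\gamma}})$. It is known that $$e_{N,s}^2(\boldsymbol{\xi})=\sum_{\emptyset\ne\mathfrak{u}\subseteq[s]}\gamma_{\mathfrak{u}}\sum_{\boldsymbol{h}_{\mathfrak{u}}\in\mathcal{D}_{\mathfrak{u}}(\boldsymbol{\xi}_{\mathfrak{u}})}\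 \prod_{j\in\mathfrak{u}}|h_j|^{-\alpha},\qquad \mathcal{D}_{\mathfrak{u}}(\boldsymbol{\xi}_{\mathfrak{u}})=\{\boldsymbol{h}_{\mathfrak{u}}\in\mathbb{Z}_*^{|\mathfrak{u}|}:\boldsymbol{h}_{\mathfrak{u}}\cdot\boldsymbol{\xi}_{\mathfrak{u}}\equiv0\ (\mathrm{mod}\ N)\}.$$ Search spaces: $\mathcal{Z}_{N,w_j}=\{z\in\{1,2,\ldots,b^{m-w_j}-1\}:\gcd(z,N)=1\}$ if $w_j<m$, and $\mathcal{Z}_{N,w_j}=\{1\}$ if $w_j\ge m$. Reduced SCS algorithm: given $\boldsymbol{z}^0=(z_1^0,\ldots,z_s^0)$, for $d=1,2,\ldots,s$ successively, with $z_1,\ldots,z_{d-1}$ already selected, choose $z_d\in\mathcal{Z}_{N,w_d}$ such that $e_{N,s}^2((Y_1z_1,\ldots,Y_{d-1}z_{d-1},Y_dz_d,z_{d+1}^0,\ldots,z_s^0))$ is minimized as a function of $z_d$ over $\mathcal{Z}_{N,w_d}$. The output is $\boldsymbol{z}=(Y_1z_1,\ldots,Y_sz_s)$. *)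

theory Defs
  imports "HOL-Analysis.Analysis" "HOL-Number_Theory.Cong"
begin

definition unit_cube :: "nat \<Rightarrow> (nat \<Rightarrow> real) set" where
  "unit_cube s = {1..s} \<rightarrow>\<^sub>E {0..1}"

definition ip_norm :: "('f \<Rightarrow> 'f \<Rightarrow> complex) \<Rightarrow> 'f \<Rightarrow> real" where
  "ip_norm ip f = sqrt (Re (ip f f))"

text \<open>
  Complex functions on \<open>X\<close> are represented by functions on the whole type that vanish off \<open>X\<close>, so
  that equality of functions on \<open>X\<close> is equality in HOL. The inner product is linear in its first
  argument and is only constrained on \<open>H\<close>. By the Moore-Aronszajn theorem, \<open>K\<close> determines
  \<open>H\<close> and the restriction of \<open>ip\<close> to \<open>H\<close>.
\<close>

locale rkhs =
  fixes X :: "'a set"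
    and K :: "'a \<Rightarrow> 'a \<Rightarrow> complex"
    and H :: "('a \<Rightarrow> complex) set"
    and ip :: "('a \<Rightarrow> complex) \<Rightarrow> ('a \<Rightarrow> complex) \<Rightarrow> complex"
  assumes supported: "\<And>f x. f \<in> H \<Longrightarrow> x \<notin> X \<Longrightarrow> f x = 0"
    and zero_closed: "(\<lambda>x. 0) \<in> H"
    and add_closed: "\<And>f g. f \<in> H \<Longrightarrow> g \<in> H \<Longrightarrow> (\<lambda>x. f x + g x) \<in> H"
    and scale_closed: "\<And>c f. f \<in> H \<Longrightarrow> (\<lambda>x. c * f x) \<in> H"
    and ip_add: "\<And>f g k. f \<in> H \<Longrightarrow> g \<in> H \<Longrightarrow> k \<in> H \<Longrightarrow> ip (\<lambda>x. f x + g x) k = ip f k + ip g k"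
    and ip_scale: "\<And>c f k. f \<in> H \<Longrightarrow> k \<in> H \<Longrightarrow> ip (\<lambda>x. c * f x) k = c * ip f k"
    and ip_hermitian: "\<And>f g. f \<in> H \<Longrightarrow> g \<in> H \<Longrightarrow> ip g f = cnj (ip f g)"
    and ip_nonneg: "\<And>f. f \<in> H \<Longrightarrow> 0 \<le> Re (ip f f)"
    and ip_definite: "\<And>f. f \<in> H \<Longrightarrow> ip f f = 0 \<Longrightarrow> f = (\<lambda>x. 0)"
    and complete: "Metric_space.mcomplete H (\<lambda>f g. ip_norm ip (\<lambda>x. f x - g x))"
    and kernel_in: "\<And>y. y \<in> X \<Longrightarrow> (\<lambda>x. if x \<in> X then K x y else 0) \<in> H"
    and reproducing: "\<And>f y. f \<in> H \<Longrightarrow> y \<in> X \<Longrightarrow> f y = ip f (\<lambda>x. if x \<in> X then K x y else 0)"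

definition korobov_kernel ::
  "nat \<Rightarrow> real \<Rightarrow> (nat set \<Rightarrow> real) \<Rightarrow> (nat \<Rightarrow> real) \<Rightarrow> (nat \<Rightarrow> real) \<Rightarrow> complex" where
  "korobov_kernel s \<alpha> \<gamma> x y =
     1 + (\<Sum>u\<in>Pow {1..s} - {{}}. complex_of_real (\<gamma> u) *
           (\<Sum>\<^sub>\<infinity>h\<in>u \<rightarrow>\<^sub>E (UNIV - {0 :: int}).
              exp (2 * complex_of_real pi * \<i> *
                   complex_of_real (\<Sum>j\<in>u. real_of_int (h j) * (x j - y j)))
              / complex_of_real (\<Prod>j\<in>u. real_of_int \<bar>h j\<bar> powr \<alpha>)))"

definition lattice_point :: "nat \<Rightarrow> nat \<Rightarrow> (nat \<Rightarrow> int) \<Rightarrow> nat \<Rightarrow> nat \<Rightarrow> real" where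
  "lattice_point s N \<xi> n = (\<lambda>j\<in>{1..s}. frac (real n * real_of_int (\<xi> j) / real N))"

definition worst_case_error ::
  "nat \<Rightarrow> nat \<Rightarrow> ((nat \<Rightarrow> real) \<Rightarrow> complex) set \<Rightarrow>
   (((nat \<Rightarrow> real) \<Rightarrow> complex) \<Rightarrow> ((nat \<Rightarrow> real) \<Rightarrow> complex) \<Rightarrow> complex) \<Rightarrow>
   (nat \<Rightarrow> int) \<Rightarrow> real" where
  "worst_case_error s N H ip \<xi> =
     (SUP f\<in>{f \<in> H. ip_norm ip f \<le> 1}.
        cmod ((LINT x:unit_cube s|(\<Pi>\<^sub>M j\<in>{1..s}. lborel). f x)
              - (1 / of_nat N) * (\<Sum>n<N. f (lattice_point s N \<xi> n))))"

definition search_space :: "nat \<Rightarrow> nat \<Rightarrow> nat \<Rightarrow> int set" where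
  "search_space b m v =
     (if v < m then {z \<in> {1..int (b ^ (m - v)) - 1}. coprime z (int (b ^ m))} else {1})"

text \<open>
  Minimisers need not be unique, so the algorithm is a relation: \<open>z\<close> is a possible output for the
  error functional \<open>e\<close> and the initial vector \<open>z0\<close>. Only components with index in \<open>{1..s}\<close>
  are meaningful.
\<close>

definition reduced_scs_output ::
  "((nat \<Rightarrow> int) \<Rightarrow> real) \<Rightarrow> nat \<Rightarrow> nat \<Rightarrow> nat \<Rightarrow> (nat \<Rightarrow> nat) \<Rightarrow> (nat \<Rightarrow> int) \<Rightarrow> (nat \<Rightarrow> int) \<Rightarrow> bool" where
  "reduced_scs_output e s b m w z0 z \<longleftrightarrow>
     (\<exists>\<zeta>. (\<forall>d\<in>{1..s}.
             is_arg_min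
               (\<lambda>\<eta>. (e (\<lambda>j. if j < d then int (b ^ w j) * \<zeta> j
                             else if j = d then int (b ^ w d) * \<eta> else z0 j))\<^sup>2)
               (\<lambda>\<eta>. \<eta> \<in> search_space b m (w d)) (\<zeta> d))
        \<and> (\<forall>j\<in>{1..s}. z j = int (b ^ w j) * \<zeta> j))"

end

theory Submission
  imports Defs
begin

text \<open>
  The error of a vector depends only on its residues modulo \<open>N\<close>, so \<open>\<zeta> d = zbar d\<close> is an admissible
  choice that leaves the current error unchanged, and each minimisation step can only decrease the
  squared error. To pass from squared errors to errors one needs that the supremum defining the
  worst-case error is nonnegative; as the supremum of an unbounded set of reals is a junk value,
  this requires a uniform bound on the unit ball. It follows from the reproducing property and
  Cauchy-Schwarz, because the Korobov kernel is constant on the diagonal.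
\<close>

text \<open>Subtracting from \<open>f\<close> its orthogonal projection onto \<open>g\<close> leaves
  a vector of nonnegative squared norm. The axioms for \<open>ip\<close> hold on \<open>H\<close>
  only, so each vector formed must be shown to lie in \<open>H\<close>.\<close>

lemma (in rkhs) Cauchy_Schwarz:
  assumes f: "f \<in> H" and g: "g \<in> H"
  shows "cmod (ip f g) \<le> ip_norm ip f * ip_norm ip g"
proof (cases "ip g g = 0")
  case True
  \<comment> \<open>The zero function is written as a multiple of \<open>f\<close> so that
    \<open>ip_scale\<close> yields \<open>ip g f = 0\<close>.\<close>
  have "g = (\<lambda>x. 0 * f x)"
    using ip_definite[OF g True] by simp
  then have "ip g f = 0"
    using ip_scale[OF f f, of 0] by simp
  then have "ip f g = 0"
    using ip_hermitian[OF g f] by simp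
  then show ?thesis
    using ip_nonneg[OF f] ip_nonneg[OF g] by (simp add: ip_norm_def)
next
  case False
  define G where "G = Re (ip g g)"
  have gg: "ip g g = of_real G"
    using ip_hermitian[OF g g] by (simp add: G_def complex_eq_iff)
  then have G: "G > 0"
    using False ip_nonneg[OF g] by (auto simp: G_def less_le)
  \<comment> \<open>The coefficient that makes \<open>h\<close> orthogonal to
    \<open>g\<close>.\<close>
  define c where "c = - ip f g / of_real G"
  define h where "h = (\<lambda>x. f x + c * g x)"
  have cg: "(\<lambda>x. c * g x) \<in> H" using g by (rule scale_closed)
  have h: "h \<in> H" unfolding h_def using f cg by (rule add_closed)
  have expand: "ip h k = ip f k + c * ip g k" if "k \<in> H" for k
    unfolding h_def using ip_add[OF f cg that] ip_scale[OF g that] by simp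
  have "ip h g = 0"
    using expand[OF g] G by (simp add: gg c_def)
  then have "ip g h = 0"
    using ip_hermitian[OF h g] by simp
  \<comment> \<open>As \<open>ip g h = 0\<close>, expanding the first argument of
    \<open>ip h h\<close> leaves \<open>ip f h\<close>, the conjugate of
    \<open>ip h f\<close>.\<close>
  then have "ip h h = cnj (ip f f + c * cnj (ip f g))"
    using expand[OF h] ip_hermitian[OF h f] expand[OF f] ip_hermitian[OF f g] by simp
  moreover have "c * cnj (ip f g) = - of_real ((cmod (ip f g))\<^sup>2 / G)"
    by (simp add: c_def complex_norm_square del: of_real_power)
  ultimately have "Re (ip h h) = Re (ip f f) - (cmod (ip f g))\<^sup>2 / G"
    by simp
  with ip_nonneg[OF h] have "(cmod (ip f g))\<^sup>2 \<le> Re (ip f f) * G"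
    using G by (simp add: field_simps)
  then have "sqrt ((cmod (ip f g))\<^sup>2) \<le> sqrt (Re (ip f f) * G)"
    by (rule real_sqrt_le_mono)
  then show ?thesis
    by (simp add: ip_norm_def G_def real_sqrt_mult)
qed

text \<open>Evaluation at \<open>y\<close> is the inner product with the kernel section at
  \<open>y\<close>, whose squared norm is \<open>K y y\<close>.\<close>

lemma (in rkhs) pointwise_bound:
  assumes f: "f \<in> H" and y: "y \<in> X"
  shows "cmod (f y) \<le> ip_norm ip f * sqrt (Re (K y y))"
proof -
  let ?k = "\<lambda>x. if x \<in> X then K x y else 0"
  have "ip ?k ?k = K y y"
    using reproducing[OF kernel_in[OF y] y] y by simp
  then show ?thesis
    using Cauchy_Schwarz[OF f kernel_in[OF y]] reproducing[OF f y] by (simp add: ip_norm_def)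
qed

text \<open>The kernel sees its arguments only through the differences \<open>x j - y j\<close>,
  which vanish on the diagonal. This makes the pointwise bound uniform over the cube.\<close>

lemma korobov_kernel_diag: "korobov_kernel s \<alpha> \<gamma> x x = korobov_kernel s \<alpha> \<gamma> y y"
  by (simp add: korobov_kernel_def)

lemma emeasure_unit_cube: "emeasure (\<Pi>\<^sub>M j\<in>{1..s}. lborel) (unit_cube s) = 1"
proof -
  interpret product_sigma_finite "\<lambda>_::nat. lborel :: real measure" by standard
  show ?thesis
    unfolding unit_cube_def by (subst emeasure_PiM) auto
qed

lemma sets_unit_cube: "unit_cube s \<in> sets (\<Pi>\<^sub>M j\<in>{1..s}. lborel)"
  unfolding unit_cube_def by (intro sets_PiM_I_finite) auto

text \<open>The cube has measure 1. The bound also covers non-integrable \<open>f\<close>, whose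
  integral is 0 by convention, since \<open>C\<close> is nonnegative.\<close>

lemma norm_LINT_unit_cube_le:
  fixes f :: "(nat \<Rightarrow> real) \<Rightarrow> complex"
  assumes "\<And>x. x \<in> unit_cube s \<Longrightarrow> cmod (f x) \<le> C"
  shows "cmod (LINT x:unit_cube s|(\<Pi>\<^sub>M j\<in>{1..s}. lborel). f x) \<le> C"
proof -
  let ?M = "\<Pi>\<^sub>M j\<in>{1..s}. lborel :: real measure"
  have "(\<lambda>j\<in>{1..s}. 0) \<in> unit_cube s" by (auto simp: unit_cube_def)
  then have C: "C \<ge> 0" using assms norm_ge_zero order_trans by blast
  have int: "integrable ?M (\<lambda>x. C * indicator (unit_cube s) x)"
    by (intro integrable_mult_right integrable_real_indicator)
      (simp_all only: sets_unit_cube emeasure_unit_cube, simp)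
  have "cmod (LINT x:unit_cube s|?M. f x) \<le> (LINT x|?M. cmod (indicator (unit_cube s) x *\<^sub>R f x))"
    unfolding set_lebesgue_integral_def by (rule integral_norm_bound)
  also have "\<dots> \<le> (LINT x|?M. C * indicator (unit_cube s) x)"
    using assms C by (intro integral_mono' int) (auto simp: indicator_def)
  also have "\<dots> = C"
    using sets.sets_into_space[OF sets_unit_cube[of s]] emeasure_unit_cube[of s]
    by (simp add: measure_def Int_absorb2)
  finally show ?thesis .
qed

lemma lattice_point_in_unit_cube: "lattice_point s N \<xi> n \<in> unit_cube s"
  by (auto simp: lattice_point_def unit_cube_def frac_ge_0 less_imp_le[OF frac_lt_1])

lemma worst_case_error_nonneg:
  assumes "rkhs (unit_cube s) (korobov_kernel s \<alpha> \<gamma>) H ip"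
  shows "0 \<le> worst_case_error s N H ip \<xi>"
proof -
  interpret rkhs "unit_cube s" "korobov_kernel s \<alpha> \<gamma>" H ip by fact
  define B where "B = {f \<in> H. ip_norm ip f \<le> 1}"
  \<comment> \<open>The point \<open>\<lambda>_. 0\<close> merely names the common diagonal value;
    it need not belong to \<open>unit_cube s\<close>, whose elements are \<open>undefined\<close>
    off \<open>{1..s}\<close>.\<close>
  define C where "C = sqrt (Re (korobov_kernel s \<alpha> \<gamma> (\<lambda>_. 0) (\<lambda>_. 0)))"
  define err where "err = (\<lambda>f :: (nat \<Rightarrow> real) \<Rightarrow> complex.
    (LINT x:unit_cube s|(\<Pi>\<^sub>M j\<in>{1..s}. lborel). f x)
      - (1 / of_nat N) * (\<Sum>n<N. f (lattice_point s N \<xi> n)))"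
  have "ip (\<lambda>x. 0) (\<lambda>x. 0) = 0"
    using ip_scale[OF zero_closed zero_closed, of 0] by simp
  then have zero: "(\<lambda>x. 0) \<in> B"
    by (simp add: B_def zero_closed ip_norm_def)
  have bound: "cmod (f x) \<le> C" if "f \<in> B" "x \<in> unit_cube s" for f x
  proof -
    have C: "C = sqrt (Re (korobov_kernel s \<alpha> \<gamma> x x))"
      unfolding C_def by (subst korobov_kernel_diag[of _ _ _ _ x]) (rule refl)
    \<comment> \<open>\<open>sqrt\<close> is negative on negative reals, so the sign of
      \<open>C\<close> comes from the kernel value being the squared norm of the section at
      \<open>x\<close>.\<close>
    have "C \<ge> 0"
      using ip_nonneg[OF kernel_in[OF that(2)]] reproducing[OF kernel_in[OF that(2)] that(2)] that
      by (simp add: C)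
    then have "ip_norm ip f * C \<le> 1 * C"
      using that by (intro mult_right_mono) (auto simp: B_def)
    then show ?thesis
      using pointwise_bound[of f x] that C by (simp add: B_def)
  qed
  \<comment> \<open>The summands bound the integral and the quadrature rule; the second equals
    \<open>C\<close> if \<open>N > 0\<close> and 0 if \<open>N = 0\<close>.\<close>
  have "cmod (err f) \<le> C + cmod (1 / of_nat N) * (of_nat N * C)" if "f \<in> B" for f
  proof -
    have "cmod (\<Sum>n<N. f (lattice_point s N \<xi> n)) \<le> of_nat (card {..<N}) * C"
      using bound[OF that lattice_point_in_unit_cube] by (intro sum_norm_bound)
    then have "cmod (1 / of_nat N * (\<Sum>n<N. f (lattice_point s N \<xi> n)))
        \<le> cmod (1 / of_nat N) * (of_nat N * C)"
      unfolding norm_mult by (intro mult_left_mono) auto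
    with norm_LINT_unit_cube_le[OF bound[OF that]] show ?thesis
      unfolding err_def by (intro norm_triangle_le_diff add_mono)
  qed
  then have "bdd_above ((\<lambda>f. cmod (err f)) ` B)"
    by (rule bdd_aboveI2)
  then have "0 \<le> (SUP f\<in>B. cmod (err f))"
    using zero by (rule cSUP_upper2) (rule norm_ge_zero)
  then show ?thesis
    by (simp add: worst_case_error_def B_def err_def)
qed

text \<open>Adding \<open>k * N\<close> to a component shifts the argument of \<open>frac\<close> by
  the integer \<open>n * k\<close>.\<close>

lemma lattice_point_cong:
  assumes "N > 0" and "\<And>j. j \<in> {1..s} \<Longrightarrow> [\<xi> j = \<eta> j] (mod int N)"
  shows "lattice_point s N \<xi> n = lattice_point s N \<eta> n"
  unfolding lattice_point_def
proof (rule restrict_ext)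
  fix j assume "j \<in> {1..s}"
  then obtain k where "\<xi> j = \<eta> j + k * int N"
    using assms(2)[of j] by (metis cong_iff_lin cong_sym mult.commute)
  then have "real n * real_of_int (\<xi> j) / real N
      = real n * real_of_int (\<eta> j) / real N + of_int (int n * k)"
    using \<open>N > 0\<close> by (simp add: field_simps)
  then show "frac (real n * real_of_int (\<xi> j) / real N) = frac (real n * real_of_int (\<eta> j) / real N)"
    by (simp only: frac_add_of_int_right)
qed

lemma worst_case_error_cong:
  assumes "N > 0" and "\<And>j. j \<in> {1..s} \<Longrightarrow> [\<xi> j = \<eta> j] (mod int N)"
  shows "worst_case_error s N H ip \<xi> = worst_case_error s N H ip \<eta>"
  unfolding worst_case_error_def using lattice_point_cong[OF assms] by simp

text \<open>The descent argument, by induction on the number of coordinates chosen, for any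
  functional \<open>e\<close> that depends only on residues modulo \<open>N\<close>.\<close>

lemma reduced_scs_output_le:
  fixes e :: "(nat \<Rightarrow> int) \<Rightarrow> real"
  assumes e_cong: "\<And>\<xi> \<eta>. (\<And>j. j \<in> {1..s} \<Longrightarrow> [\<xi> j = \<eta> j] (mod int N)) \<Longrightarrow> e \<xi> = e \<eta>"
    and zbar: "\<And>j. j \<in> {1..s} \<Longrightarrow> zbar j \<in> search_space b m (w j)"
    and z0: "\<And>j. j \<in> {1..s} \<Longrightarrow> [z0 j = int (b ^ w j) * zbar j] (mod int N)"
    and out: "reduced_scs_output e s b m w z0 z"
  shows "(e z)\<^sup>2 \<le> (e z0)\<^sup>2"
proof -
  obtain \<zeta> where
    min: "\<And>d. d \<in> {1..s} \<Longrightarrow> is_arg_min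
      (\<lambda>\<eta>. (e (\<lambda>j. if j < d then int (b ^ w j) * \<zeta> j
                    else if j = d then int (b ^ w d) * \<eta> else z0 j))\<^sup>2)
      (\<lambda>\<eta>. \<eta> \<in> search_space b m (w d)) (\<zeta> d)"
    and z: "\<And>j. j \<in> {1..s} \<Longrightarrow> z j = int (b ^ w j) * \<zeta> j"
    using out unfolding reduced_scs_output_def by blast
  \<comment> \<open>The current vector after \<open>d\<close> steps. \<open>\<xi> 0\<close> can
    differ from \<open>z0\<close> only at index 0, which \<open>e\<close> ignores.\<close>
  define \<xi> where "\<xi> d = (\<lambda>j. if j \<le> d then int (b ^ w j) * \<zeta> j else z0 j)" for d
  have step: "(e (\<xi> (Suc d)))\<^sup>2 \<le> (e (\<xi> d))\<^sup>2" if "Suc d \<le> s" for d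
  proof -
    define v where "v \<eta> = (\<lambda>j. if j < Suc d then int (b ^ w j) * \<zeta> j
      else if j = Suc d then int (b ^ w (Suc d)) * \<eta> else z0 j)" for \<eta>
    have "is_arg_min (\<lambda>\<eta>. (e (v \<eta>))\<^sup>2) (\<lambda>\<eta>. \<eta> \<in> search_space b m (w (Suc d))) (\<zeta> (Suc d))"
      using min[of "Suc d"] that unfolding v_def by simp
    then have "(e (v (\<zeta> (Suc d))))\<^sup>2 \<le> (e (v (zbar (Suc d))))\<^sup>2"
      using zbar[of "Suc d"] that by (simp add: is_arg_min_linorder)
    moreover have "v (\<zeta> (Suc d)) = \<xi> (Suc d)"
      by (auto simp: v_def \<xi>_def)
    \<comment> \<open>Choosing \<open>zbar (Suc d)\<close> reproduces \<open>z0 (Suc d)\<close>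
      modulo \<open>N\<close>, so this competitor has the error of the previous step.\<close>
    moreover have "e (v (zbar (Suc d))) = e (\<xi> d)"
      using z0 that by (intro e_cong) (auto simp: v_def \<xi>_def intro: cong_sym)
    ultimately show ?thesis by simp
  qed
  have "(e (\<xi> d))\<^sup>2 \<le> (e (\<xi> 0))\<^sup>2" if "d \<le> s" for d
    using that by (induction d) (auto intro: order_trans[OF step])
  moreover have "e (\<xi> s) = e z" "e (\<xi> 0) = e z0"
    by (rule e_cong; simp add: \<xi>_def z)+
  ultimately show ?thesis by (metis order_refl)
qed

theorem theorem9:
  fixes b m N s :: nat and \<alpha> :: real and \<gamma> :: "nat set \<Rightarrow> real"
    and w :: "nat \<Rightarrow> nat" and z0 zbar z :: "nat \<Rightarrow> int"
    and H :: "((nat \<Rightarrow> real) \<Rightarrow> complex) set"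
    and ip :: "((nat \<Rightarrow> real) \<Rightarrow> complex) \<Rightarrow> ((nat \<Rightarrow> real) \<Rightarrow> complex) \<Rightarrow> complex"
  assumes "prime b" and "m \<ge> 1" and "N = b ^ m" and "s \<ge> 1" and "\<alpha> > 1"
    and "\<And>u. u \<subseteq> {1..s} \<Longrightarrow> \<gamma> u > 0" and "\<gamma> {} = 1"
    and "mono_on {1..s} w"
    and "rkhs (unit_cube s) (korobov_kernel s \<alpha> \<gamma>) H ip"
    and "\<And>j. j \<in> {1..s} \<Longrightarrow> z0 j \<in> {0..int N - 1}"
    and "\<And>j. j \<in> {1..s} \<Longrightarrow> zbar j \<in> search_space b m (w j)"
    and "\<And>j. j \<in> {1..s} \<Longrightarrow> [z0 j = int (b ^ w j) * zbar j] (mod int N)"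
    and "reduced_scs_output (worst_case_error s N H ip) s b m w z0 z"
  shows "worst_case_error s N H ip z \<le> worst_case_error s N H ip z0"
proof -
  have "N > 0"
    using assms(1,3) prime_gt_0_nat by simp
  then have "(worst_case_error s N H ip z)\<^sup>2 \<le> (worst_case_error s N H ip z0)\<^sup>2"
    using assms(11-13) by (intro reduced_scs_output_le worst_case_error_cong)
  \<comment> \<open>Removing the squares uses nonnegativity of the error of
    \<open>z0\<close>.\<close>
  then show ?thesis
    using worst_case_error_nonneg[OF assms(9)] by (rule power2_le_imp_le)
qed

end
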